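(* Let $p,q,d$ be positive integers with $p\ge q\ge d+1$. Then there exists a finite constant $c=c(p,q,d)<\infty$ such that $M(p,q;d)\le c$; that is, for every (finite or infinite) family $\mathcal{F}$ of nonempty compact convex sets in $\mathbb{R}^d$ that has the $(p,q)$ property there is a set of at most $c$ points in $\mathbb{R}^d$ that intersects each member of $\mathcal{F}$.
   Context: For integers $p\ge q$, a family of sets has the $(p,q)$ property if among any $p$ members of the family some $q$ have a nonempty intersection. A family $\mathcal{H}$ of sets is $k$-pierceable if it can be split into $k$ or fewer subfamilies, each having a nonempty intersection (for nonempty sets in $\mathbb{R}^d$: if there is a set of at most $k$ points meeting every member of $\mathcal{H}$). The piercing number $P(\mathcal{H})$ is the minimum $k$ such that $\mathcal{H}$ is $k$-pierceable, with $P(\mathcal{H})=\infty$ if no such finite $k$ exists. For $p\ge q\ge d+1$, $M(p,q;d)$ denotes the maximum possible (possibly infinite) piercing number of a family of nonempty compact convex sets in $\mathbb{R}^d$ with the $(p,q)$ property. The constant $c$ depends only on $p,q,d$, not on the family. *)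

theory Defs
  imports "HOL-Analysis.Analysis" "HOL-Library.Disjoint_Sets" "HOL-Library.Extended_Nat"
begin

text \<open>
  Families are sets of sets, so ``p members'' means p distinct sets. A family with repeated
  members that has the (p,q) property has an underlying set of sets with that property and the
  same piercing number, so nothing is lost.
\<close>

definition pq_property :: "nat \<Rightarrow> nat \<Rightarrow> 'a set set \<Rightarrow> bool" where
  "pq_property p q \<F> \<longleftrightarrow>
     (\<forall>\<G>. \<G> \<subseteq> \<F> \<and> finite \<G> \<and> card \<G> = p \<longrightarrow>
        (\<exists>\<H>. \<H> \<subseteq> \<G> \<and> card \<H> = q \<and> \<Inter>\<H> \<noteq> {}))"

definition pierceable :: "nat \<Rightarrow> 'a set set \<Rightarrow> bool" where
  "pierceable k \<H> \<longleftrightarrow>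
     (\<exists>P. partition_on \<H> P \<and> finite P \<and> card P \<le> k \<and> (\<forall>\<G>\<in>P. \<Inter>\<G> \<noteq> {}))"

definition piercing_number :: "'a set set \<Rightarrow> enat" where
  "piercing_number \<H> =
     (if \<exists>k. pierceable k \<H> then enat (LEAST k. pierceable k \<H>) else \<infinity>)"

definition compact_convex_family :: "'a::real_normed_vector set set \<Rightarrow> bool" where
  "compact_convex_family \<F> \<longleftrightarrow> (\<forall>A\<in>\<F>. A \<noteq> {} \<and> compact A \<and> convex A)"

text \<open>
  This is M(p,q;d) for \<open>d = CARD('n)\<close>. The supremum in \<^typ>\<open>enat\<close> is \<open>\<infinity>\<close> when the piercing
  numbers are unbounded, and is an attained maximum otherwise.
\<close>

definition max_piercing_number :: "nat \<Rightarrow> nat \<Rightarrow> 'n::finite itself \<Rightarrow> enat" where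
  "max_piercing_number p q _ =
     (SUP \<F> \<in> {\<F> :: (real ^ 'n) set set. compact_convex_family \<F> \<and> pq_property p q \<F>}.
        piercing_number \<F>)"

end

theory Submission
  imports Defs
begin

text \<open>
  The Alon--Kleitman argument, carried out by counting. By the \<open>(p, q)\<close> property a positive fraction
  of the \<open>(d + 1)\<close>-tuples of a finite subfamily, repetitions and multiplicities allowed, has a common
  point, so by the fractional Helly theorem some point lies in a positive fraction of the members.
  Duality turns this into a finite sequence of points a fixed fraction of which lies in every
  member, and a weak \<open>\<epsilon>\<close>-net for this sequence pierces the subfamily. Fractional Helly holds because
  the point of least norm in the intersection of \<open>d + 1\<close> convex sets is already determined by \<open>d\<close> of
  them. Applied to convex hulls of tuples of points it also yields the selection lemma behind the
  weak \<open>\<epsilon>\<close>-nets. Infinite families are handled by compactness.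
\<close>

subsection \<open>Helly and Radon theorems for indexed families\<close>

text \<open>Indices rather than sets are counted because sets may repeat. If two indices carry the
  same set, dropping one changes nothing and the hypothesis itself gives a common point; otherwise
  Helly's theorem applies, since any d + 1 of the sets omit some index.\<close>

lemma Helly_indexed:
  fixes T :: "'i \<Rightarrow> 'a::euclidean_space set"
  assumes "finite J" "DIM('a) + 2 \<le> card J"
    and convex: "\<And>j. j \<in> J \<Longrightarrow> convex (T j)"
    and inter: "\<And>k. k \<in> J \<Longrightarrow> (\<Inter>j\<in>J - {k}. T j) \<noteq> {}"
  shows "(\<Inter>j\<in>J. T j) \<noteq> {}"
proof (cases "inj_on T J")
  case True
  have "\<Inter>(T ` J) \<noteq> {}"
  proof (rule Helly)
    show "DIM('a) + 1 \<le> card (T ` J)"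
      using assms(2) True by (simp add: card_image)
    show "\<forall>s\<in>T ` J. convex s" using convex by auto
  next
    fix t assume t: "t \<subseteq> T ` J" "card t = DIM('a) + 1"
    have "t \<noteq> T ` J" using t(2) assms(2) True by (auto simp: card_image)
    then obtain k where k: "k \<in> J" "T k \<notin> t" using t(1) by blast
    have "t \<subseteq> T ` (J - {k})" using t(1) k by blast
    then have "(\<Inter>j\<in>J - {k}. T j) \<subseteq> \<Inter>t" by blast
    then show "\<Inter>t \<noteq> {}" using inter[OF k(1)] by blast
  qed
  then show ?thesis .
next
  case False
  then obtain k l where kl: "k \<in> J" "l \<in> J" "k \<noteq> l" "T k = T l"
    by (auto simp: inj_on_def)
  then have "T ` J = T ` (J - {k})" by blast
  then show ?thesis using inter[OF kl(1)] by simp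
qed

text \<open>
  Apply Helly's theorem to the given sets and the open ball around \<open>0\<close> that just misses their
  intersection: since all of these together have no common point, the intersection of some
  \<open>DIM('a)\<close> of the given sets already misses the ball.
\<close>

lemma closest_point_Inter_remove:
  fixes S :: "'i \<Rightarrow> 'a::euclidean_space set"
  assumes K: "finite K" "card K = DIM('a) + 1"
    and S: "\<And>k. k \<in> K \<Longrightarrow> closed (S k)" "\<And>k. k \<in> K \<Longrightarrow> convex (S k)"
    and ne: "(\<Inter>k\<in>K. S k) \<noteq> {}"
  shows "\<exists>k\<in>K. closest_point (\<Inter>j\<in>K - {k}. S j) 0 \<in> S k"
proof -
  define v where "v = closest_point (\<Inter>k\<in>K. S k) 0"
  have cl: "closed (\<Inter>k\<in>L. S k)" "convex (\<Inter>k\<in>L. S k)" if "L \<subseteq> K" for L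
    using that S by (auto intro!: closed_INT convex_INT)
  have v: "v \<in> (\<Inter>k\<in>K. S k)"
    unfolding v_def using cl(1)[of K] ne by (intro closest_point_in_set) auto
  have "\<exists>k\<in>K. \<forall>x\<in>(\<Inter>j\<in>K - {k}. S j). norm v \<le> norm x"
  proof (rule ccontr)
    assume "\<not> ?thesis"
    then have small: "\<exists>x\<in>(\<Inter>j\<in>K - {k}. S j). norm x < norm v" if "k \<in> K" for k
      using that by (meson not_le)
    define T where "T = case_option (ball 0 (norm v)) S"
    have "(\<Inter>j\<in>insert None (Some ` K). T j) \<noteq> {}"
    proof (rule Helly_indexed)
      show "finite (insert None (Some ` K))" using K by simp
      show "DIM('a) + 2 \<le> card (insert None (Some ` K))"
        using K by (simp add: card_image)
    next
      fix j assume "j \<in> insert None (Some ` K)"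
      then show "convex (T j)" using S by (auto simp: T_def)
    next
      fix j assume "j \<in> insert None (Some ` K)"
      \<comment> \<open>Without the ball, the remaining sets share \<open>v\<close>. Without
        \<open>S k\<close>, the point of norm below \<open>norm v\<close> supplied by
        \<open>small\<close> lies in all the others, the ball included.\<close>
      then consider "j = None" | k where "j = Some k" "k \<in> K" by blast
      then show "(\<Inter>i\<in>insert None (Some ` K) - {j}. T i) \<noteq> {}"
      proof cases
        case 1
        have "v \<in> T i" if "i \<in> insert None (Some ` K) - {j}" for i
          using that 1 v by (auto simp: T_def)
        then show ?thesis by blast
      next
        case 2
        then obtain x where x: "x \<in> (\<Inter>j\<in>K - {k}. S j)" "norm x < norm v"
          using small by blast
        have "x \<in> T i" if "i \<in> insert None (Some ` K) - {j}" for i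
          using that 2 x by (auto simp: T_def)
        then show ?thesis by blast
      qed
    qed
    then obtain x where "x \<in> (\<Inter>k\<in>K. S k)" "norm x < norm v"
      by (auto simp: T_def)
    then show False
      using closest_point_le[OF cl(1)[of K], of x 0] by (simp add: v_def)
  qed
  then obtain k where k: "k \<in> K" "\<forall>x\<in>(\<Inter>j\<in>K - {k}. S j). norm v \<le> norm x"
    by blast
  \<comment> \<open>\<open>v\<close> also lies in the larger intersection without \<open>S k\<close>
    and has least norm there, so by uniqueness it is the closest point to 0.\<close>
  have "v = closest_point (\<Inter>j\<in>K - {k}. S j) 0"
    using k v cl[of "K - {k}"] by (intro closest_point_unique) auto
  then show ?thesis using k(1) v by auto
qed

text \<open>Distinct points are affinely dependent by their number, so Radon's theorem applies; a
  repeated point splits off as one copy against the rest, which contains the other copy.\<close>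

lemma Radon_indexed:
  fixes z :: "'i \<Rightarrow> 'a::euclidean_space"
  assumes "finite J" "DIM('a) + 2 \<le> card J"
  shows "\<exists>V\<subseteq>J. convex hull (z ` V) \<inter> convex hull (z ` (J - V)) \<noteq> {}"
proof (cases "inj_on z J")
  case True
  then have "affine_dependent (z ` J)"
    using assms by (intro affine_dependent_biggerset) (simp_all add: card_image)
  then obtain M P where MP: "M \<subseteq> z ` J" "P \<subseteq> z ` J" "M \<inter> P = {}"
    "convex hull M \<inter> convex hull P \<noteq> {}"
    by (rule Radon)
  define V where "V = {j\<in>J. z j \<in> M}"
  have "M \<subseteq> z ` V" "P \<subseteq> z ` (J - V)"
    using MP(1-3) unfolding V_def by blast+
  then have "convex hull M \<subseteq> convex hull (z ` V)" "convex hull P \<subseteq> convex hull (z ` (J - V))"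
    by (simp_all add: hull_mono)
  then show ?thesis using MP(4) by (intro exI[of _ V]) (auto simp: V_def)
next
  case False
  then obtain k l where kl: "k \<in> J" "l \<in> J" "k \<noteq> l" "z k = z l"
    by (auto simp: inj_on_def)
  then have "z k \<in> convex hull (z ` {k}) \<inter> convex hull (z ` (J - {k}))"
    by (auto intro!: hull_inc)
  then show ?thesis using kl(1) by (intro exI[of _ "{k}"]) auto
qed

text \<open>Each application of Radon's theorem doubles the number of classes. Split the points into
  d + 2 blocks, colour each block inductively so that the hulls of its classes share a point, and
  apply Radon to these d + 2 points. Every class splits in two by the side its block lies on, and
  the Radon point is in all new hulls. The colouring \<open>\<phi>\<close> encodes the
  partition.\<close>

lemma iterated_Radon:
  "\<exists>N. \<forall>y :: nat \<Rightarrow> 'a::euclidean_space. \<exists>(\<phi> :: nat \<Rightarrow> nat) z.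
     \<forall>j<2 ^ r. z \<in> convex hull (y ` {i. i < N \<and> \<phi> i = j})"
proof (induction r)
  case 0
  have "y 0 \<in> convex hull (y ` {i. i < 1 \<and> (0::nat) = 0})" for y :: "nat \<Rightarrow> 'a"
    by (auto intro!: hull_inc)
  then show ?case by (intro exI[of _ 1] allI exI[of _ "\<lambda>_. 0"]) fastforce
next
  case (Suc r)
  then obtain N where N: "\<And>y :: nat \<Rightarrow> 'a. \<exists>(\<phi> :: nat \<Rightarrow> nat) z.
     \<forall>j<2 ^ r. z \<in> convex hull (y ` {i. i < N \<and> \<phi> i = j})"
    by blast
  define D where "D = DIM('a) + 2"
  show ?case
  proof (intro exI[of _ "D * N"] allI)
    fix y :: "nat \<Rightarrow> 'a"
    have "\<forall>b. \<exists>\<phi> z. \<forall>j<2 ^ r. z \<in> convex hull ((\<lambda>i. y (b * N + i)) ` {i. i < N \<and> \<phi> i = (j::nat)})"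
      using N by blast
    then obtain \<phi> :: "nat \<Rightarrow> nat \<Rightarrow> nat" and z where z: "\<And>b j. j < 2 ^ r \<Longrightarrow>
        z b \<in> convex hull ((\<lambda>i. y (b * N + i)) ` {i. i < N \<and> \<phi> b i = j})"
      by metis
    obtain V where V: "V \<subseteq> {..<D}"
      "convex hull (z ` V) \<inter> convex hull (z ` ({..<D} - V)) \<noteq> {}"
      using Radon_indexed[of "{..<D}" z] by (auto simp: D_def)
    then obtain x where x: "x \<in> convex hull (z ` V)" "x \<in> convex hull (z ` ({..<D} - V))"
      by blast
    \<comment> \<open>Index \<open>m\<close> is position \<open>m mod N\<close> of block
      \<open>m div N\<close>. The last binary digit of its new colour is the Radon side of the
      block, the rest its colour within the block.\<close>
    define \<psi> where "\<psi> m = 2 * \<phi> (m div N) (m mod N) + (if m div N \<in> V then 1 else 0)" for m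
    have block: "(\<lambda>i. y (b * N + i)) ` {i. i < N \<and> \<phi> b i = j}
        \<subseteq> y ` {i. i < D * N \<and> \<psi> i = 2 * j + (if b \<in> V then 1 else 0)}" if "b < D" for b j
    proof -
      have "b * N + i < D * N" if "i < N" for i
      proof -
        have "b * N + i < Suc b * N" using that by simp
        also have "\<dots> \<le> D * N" using \<open>b < D\<close> by (intro mult_right_mono) auto
        finally show ?thesis .
      qed
      then show ?thesis by (auto simp: \<psi>_def)
    qed
    have "x \<in> convex hull (y ` {i. i < D * N \<and> \<psi> i = j})" if j: "j < 2 ^ Suc r" for j
    proof -
      \<comment> \<open>The parity of \<open>j\<close> tells on which Radon side the blocks feeding
        class \<open>j\<close> lie.\<close>
      define W where "W = (if odd j then V else {..<D} - V)"
      have W: "x \<in> convex hull (z ` W)" using x by (simp add: W_def)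
      have jj: "j = 2 * (j div 2) + (if b \<in> V then 1 else 0)" "b < D" if "b \<in> W" for b
        using that V(1) by (auto simp: W_def split: if_splits)
      have "z b \<in> convex hull (y ` {i. i < D * N \<and> \<psi> i = j})" if "b \<in> W" for b
        using z[of "j div 2" b] hull_mono[OF block[of b "j div 2"], of convex] jj[OF that] j
        by auto
      then have "convex hull (z ` W) \<subseteq> convex hull (y ` {i. i < D * N \<and> \<psi> i = j})"
        by (intro hull_minimal) auto
      then show ?thesis using W by blast
    qed
    then show "\<exists>\<phi> z. \<forall>j<2 ^ Suc r. z \<in> convex hull (y ` {i. i < D * N \<and> \<phi> i = (j::nat)})"
      by blast
  qed
qed

text \<open>Tverberg's theorem with an unspecified number of points: of the \<open>2 ^ Suc r\<close>
  classes of the iterated Radon partition, those beyond \<open>r\<close> are merged into class 0,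
  which only enlarges its hull. Extensional colourings form a finite set, as the later pigeonhole
  argument requires.\<close>

lemma Tverberg_weak:
  "\<exists>N. \<forall>y :: nat \<Rightarrow> 'a::euclidean_space. \<exists>\<phi> \<in> {..<N} \<rightarrow>\<^sub>E {..r::nat}.
     (\<Inter>j\<in>{..r}. convex hull (y ` {i. i < N \<and> \<phi> i = j})) \<noteq> {}"
proof -
  obtain N where N: "\<And>y :: nat \<Rightarrow> 'a. \<exists>(\<phi> :: nat \<Rightarrow> nat) z.
     \<forall>j<2 ^ Suc r. z \<in> convex hull (y ` {i. i < N \<and> \<phi> i = j})"
    using iterated_Radon[of "Suc r"] by blast
  have "\<exists>\<phi> \<in> {..<N} \<rightarrow>\<^sub>E {..r}. (\<Inter>j\<in>{..r}. convex hull (y ` {i. i < N \<and> \<phi> i = j})) \<noteq> {}"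
    for y :: "nat \<Rightarrow> 'a"
  proof -
    obtain \<phi> :: "nat \<Rightarrow> nat" and z
      where z: "\<And>j. j < 2 ^ Suc r \<Longrightarrow> z \<in> convex hull (y ` {i. i < N \<and> \<phi> i = j})"
      using N by blast
    define \<psi> where "\<psi> = (\<lambda>i\<in>{..<N}. if \<phi> i \<le> r then \<phi> i else 0)"
    have "z \<in> convex hull (y ` {i. i < N \<and> \<psi> i = j})" if "j \<le> r" for j
    proof -
      have "j < 2 ^ Suc r" using that less_exp[of "Suc r"] by linarith
      then have "z \<in> convex hull (y ` {i. i < N \<and> \<phi> i = j})" by (rule z)
      also have "\<dots> \<subseteq> convex hull (y ` {i. i < N \<and> \<psi> i = j})"
        using that by (intro hull_mono image_mono) (auto simp: \<psi>_def)
      finally show ?thesis .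
    qed
    moreover have "\<psi> \<in> {..<N} \<rightarrow>\<^sub>E {..r}" by (auto simp: \<psi>_def)
    ultimately show ?thesis by blast
  qed
  then show ?thesis by blast
qed

subsection \<open>Fractional Helly theorem\<close>

lemma card_PiE_pullback:
  assumes fin: "finite I" "finite J" and g: "inj_on g K" "g ` K \<subseteq> J"
    and B: "B \<subseteq> K \<rightarrow>\<^sub>E I"
  shows "card {f \<in> J \<rightarrow>\<^sub>E I. restrict (f \<circ> g) K \<in> B} = card B * card I ^ (card J - card K)"
proof -
  define L where "L = J - g ` K"
  have "bij_betw (\<lambda>f. (restrict (f \<circ> g) K, restrict f L))
      {f \<in> J \<rightarrow>\<^sub>E I. restrict (f \<circ> g) K \<in> B} (B \<times> (L \<rightarrow>\<^sub>E I))"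
  proof (rule bij_betw_byWitness[where f' =
        "\<lambda>(h, e). \<lambda>j\<in>J. if j \<in> g ` K then h (inv_into K g j) else e j"], goal_cases)
    case 1
    show ?case using g
      by (auto simp: L_def fun_eq_iff restrict_def PiE_def extensional_def)
  next
    case 2
    show ?case
    proof
      fix x assume x: "x \<in> B \<times> (L \<rightarrow>\<^sub>E I)"
      obtain h e where he: "x = (h, e)" by (cases x)
      have "h \<in> extensional K" "e \<in> extensional L" using x he B by (auto simp: PiE_def)
      then show "(\<lambda>f. (restrict (f \<circ> g) K, restrict f L))
           ((\<lambda>(h, e). \<lambda>j\<in>J. if j \<in> g ` K then h (inv_into K g j) else e j) x) = x"
        using g unfolding he
        by (auto simp: L_def fun_eq_iff restrict_def extensional_def)
    qed
  next
    case 3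
    show ?case by (auto simp: L_def)
  next
    case 4
    show ?case
    proof
      fix f assume "f \<in> (\<lambda>(h, e). \<lambda>j\<in>J. if j \<in> g ` K then h (inv_into K g j) else e j) `
          (B \<times> (L \<rightarrow>\<^sub>E I))"
      then obtain h e where he: "h \<in> B" "e \<in> L \<rightarrow>\<^sub>E I"
        and f: "f = (\<lambda>j\<in>J. if j \<in> g ` K then h (inv_into K g j) else e j)" by auto
      have h: "h \<in> K \<rightarrow>\<^sub>E I" using he B by blast
      then have "restrict (f \<circ> g) K = h"
        using g unfolding f
        by (auto simp: fun_eq_iff restrict_def PiE_def extensional_def)
      moreover have "f \<in> J \<rightarrow>\<^sub>E I"
        using h he(2) g unfolding f by (auto simp: L_def PiE_iff)
      ultimately show "f \<in> {f \<in> J \<rightarrow>\<^sub>E I. restrict (f \<circ> g) K \<in> B}" using he(1) by simp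
    qed
  qed
  then have "card {f \<in> J \<rightarrow>\<^sub>E I. restrict (f \<circ> g) K \<in> B} = card (B \<times> (L \<rightarrow>\<^sub>E I))"
    by (rule bij_betw_same_card)
  moreover have "card L = card J - card K"
    using g fin by (simp add: L_def card_Diff_subset card_image finite_subset)
  ultimately show ?thesis
    using fin by (simp add: card_cartesian_product card_PiE L_def)
qed

text \<open>For every intersecting (d + 1)-tuple some coordinate \<open>k\<close> has a set
  containing the least-norm point determined by the other d. Fixing \<open>k\<close> and these d
  coordinates leaves at most as many choices for coordinate \<open>k\<close> as the greatest number
  of sets through one point.\<close>

lemma fractional_Helly:
  fixes S :: "'i \<Rightarrow> 'a::euclidean_space set"
  assumes "finite I"
    and S: "\<And>i. i \<in> I \<Longrightarrow> closed (S i)" "\<And>i. i \<in> I \<Longrightarrow> convex (S i)"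
  shows "\<exists>z. card {f \<in> {..DIM('a)} \<rightarrow>\<^sub>E I. (\<Inter>j\<in>{..DIM('a)}. S (f j)) \<noteq> {}}
    \<le> (DIM('a) + 1) * card I ^ DIM('a) * card {i\<in>I. z \<in> S i}"
proof -
  define K where "K = {..DIM('a)}"
  have K: "finite K" "card K = DIM('a) + 1" by (simp_all add: K_def)
  \<comment> \<open>The bound ensures that a point in a maximal number of sets exists.\<close>
  have "card {i\<in>I. z \<in> S i} < Suc (card I)" for z
    using \<open>finite I\<close> by (simp add: card_mono less_Suc_eq_le)
  then obtain z where z: "\<And>y. card {i\<in>I. y \<in> S i} \<le> card {i\<in>I. z \<in> S i}"
    using ex_has_greatest_nat[of "\<lambda>_. True" undefined "\<lambda>z. card {i\<in>I. z \<in> S i}" "Suc (card I)"]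
    by auto
  define m where "m = card {i\<in>I. z \<in> S i}"
  define v where "v k f = closest_point (\<Inter>j\<in>K - {k}. S (f j)) 0" for k f
  define B where "B k = {f \<in> K \<rightarrow>\<^sub>E I. v k f \<in> S (f k)}" for k
  have card_B: "card (B k) \<le> card I ^ DIM('a) * m" if k: "k \<in> K" for k
  proof -
    \<comment> \<open>\<open>v k f\<close> ignores coordinate \<open>k\<close>: once the others are
      fixed as \<open>e\<close>, \<open>f k\<close> must index one of the at most \<open>m\<close>
      sets containing \<open>v k e\<close>. This holds for any value of \<open>v k e\<close>, even
      when the intersection defining it is empty.\<close>
    define A where "A = (SIGMA e:(K - {k}) \<rightarrow>\<^sub>E I. {i\<in>I. v k e \<in> S i})"
    have v: "v k (restrict f (K - {k})) = v k f" for f by (simp add: v_def)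
    have "card (B k) \<le> card A"
    proof (rule card_inj_on_le)
      show "inj_on (\<lambda>f. (restrict f (K - {k}), f k)) (B k)"
      proof (rule inj_onI)
        fix f g assume fg: "f \<in> B k" "g \<in> B k"
          "(restrict f (K - {k}), f k) = (restrict g (K - {k}), g k)"
        then have "f j = g j" if "j \<in> K" for j
          using that by (cases "j = k") (auto simp: fun_eq_iff restrict_def split: if_splits)
        then show "f = g" using fg(1,2) by (auto simp: B_def intro: PiE_ext)
      qed
      show "(\<lambda>f. (restrict f (K - {k}), f k)) ` B k \<subseteq> A"
      proof
        fix x assume "x \<in> (\<lambda>f. (restrict f (K - {k}), f k)) ` B k"
        then obtain f where f: "f \<in> K \<rightarrow>\<^sub>E I" "v k f \<in> S (f k)" "x = (restrict f (K - {k}), f k)"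
          by (auto simp: B_def)
        then have "restrict f (K - {k}) \<in> (K - {k}) \<rightarrow>\<^sub>E I"
          unfolding restrict_PiE_iff by blast
        then show "x \<in> A" using f k v[of f] by (auto simp: A_def simp del: restrict_apply)
      qed
      show "finite A"
        unfolding A_def using \<open>finite I\<close> K by (intro finite_SigmaI finite_PiE) simp_all
    qed
    also have "card A = (\<Sum>e\<in>(K - {k}) \<rightarrow>\<^sub>E I. card {i\<in>I. v k e \<in> S i})"
      using \<open>finite I\<close> K by (simp add: A_def finite_PiE)
    also have "\<dots> \<le> card ((K - {k}) \<rightarrow>\<^sub>E I) * m"
      using sum_bounded_above[of "(K - {k}) \<rightarrow>\<^sub>E I" "\<lambda>e. card {i\<in>I. v k e \<in> S i}" m] z
      by (simp add: m_def)
    also have "card ((K - {k}) \<rightarrow>\<^sub>E I) = card I ^ DIM('a)"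
      using K k by (simp add: card_PiE)
    finally show ?thesis .
  qed
  have "{f \<in> K \<rightarrow>\<^sub>E I. (\<Inter>j\<in>K. S (f j)) \<noteq> {}} \<subseteq> (\<Union>k\<in>K. B k)"
  proof
    fix f assume f: "f \<in> {f \<in> K \<rightarrow>\<^sub>E I. (\<Inter>j\<in>K. S (f j)) \<noteq> {}}"
    have "\<exists>k\<in>K. closest_point (\<Inter>j\<in>K - {k}. S (f j)) 0 \<in> S (f k)"
      by (rule closest_point_Inter_remove[of K "\<lambda>j. S (f j)"]) (use f K S in \<open>auto simp: PiE_def\<close>)
    then show "f \<in> (\<Union>k\<in>K. B k)" using f by (auto simp: B_def v_def)
  qed
  moreover have "finite (\<Union>k\<in>K. B k)"
    using K \<open>finite I\<close> by (auto simp: B_def intro!: finite_PiE)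
  ultimately have "card {f \<in> K \<rightarrow>\<^sub>E I. (\<Inter>j\<in>K. S (f j)) \<noteq> {}} \<le> card (\<Union>k\<in>K. B k)"
    by (intro card_mono)
  also have "\<dots> \<le> (\<Sum>k\<in>K. card (B k))" by (rule card_UN_le[OF K(1)])
  also have "\<dots> \<le> card K * (card I ^ DIM('a) * m)"
    using sum_bounded_above[of K "\<lambda>k. card (B k)"] card_B by simp
  finally have "card {f \<in> K \<rightarrow>\<^sub>E I. (\<Inter>j\<in>K. S (f j)) \<noteq> {}} \<le> (DIM('a) + 1) * card I ^ DIM('a) * m"
    unfolding K(2) mult.assoc .
  then show ?thesis unfolding K_def m_def by blast
qed

subsection \<open>Weak epsilon-nets\<close>

text \<open>Give each \<open>N\<close>-tuple a Tverberg colouring; many tuples share one colouring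
  \<open>\<phi>\<close>. Take d + 1 tuples as rows of a matrix and read entry \<open>i\<close> from
  row \<open>\<phi> i\<close>: if the result is one of those many tuples, its Tverberg point lies in
  the hulls of all rows. Hence many (d + 1)-tuples of hulls intersect, and fractional Helly gives a
  point in many hulls.\<close>

lemma first_selection:
  "\<exists>N L. 0 < L \<and> (\<forall>I (x :: 'i \<Rightarrow> 'a::euclidean_space). finite I \<longrightarrow> I \<noteq> {} \<longrightarrow>
     (\<exists>z. card I ^ N \<le> L * card {h \<in> {..<N} \<rightarrow>\<^sub>E I. z \<in> convex hull (x ` h ` {..<N})}))"
proof -
  define d where "d = DIM('a)"
  obtain N where N: "\<And>y :: nat \<Rightarrow> 'a. \<exists>\<phi> \<in> {..<N} \<rightarrow>\<^sub>E {..d}.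
     (\<Inter>j\<in>{..d}. convex hull (y ` {i. i < N \<and> \<phi> i = j})) \<noteq> {}"
    using Tverberg_weak by blast
  \<comment> \<open>\<open>(d + 1) ^ N\<close> is the number of colourings in the pigeonhole step;
    the last factor comes from fractional Helly.\<close>
  define L where "L = (d + 1) ^ N * (d + 1)"
  have "\<exists>z. card I ^ N \<le> L * card {h \<in> {..<N} \<rightarrow>\<^sub>E I. z \<in> convex hull (x ` h ` {..<N})}"
    if I: "finite I" "I \<noteq> {}" for I and x :: "'i \<Rightarrow> 'a"
  proof -
    define \<Omega> where "\<Omega> = {..<N} \<rightarrow>\<^sub>E I"
    have \<Omega>: "finite \<Omega>" "card \<Omega> = card I ^ N" "0 < card \<Omega>"
      using I by (simp_all add: \<Omega>_def finite_PiE card_PiE card_gt_0_iff)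
    define good where "good y \<phi> \<longleftrightarrow> \<phi> \<in> {..<N} \<rightarrow>\<^sub>E {..d} \<and>
      (\<Inter>j\<in>{..d}. convex hull (x ` y ` {i. i < N \<and> \<phi> i = j})) \<noteq> {}" for y \<phi>
    have "\<exists>\<phi>. good y \<phi>" for y
      using N[of "x \<circ> y"] unfolding good_def image_comp by blast
    then obtain c where c: "\<And>y. good y (c y)" by metis
    have "\<exists>\<phi>\<in>{..<N} \<rightarrow>\<^sub>E {..d}. card (c -` {\<phi>} \<inter> \<Omega>) * card ({..<N} \<rightarrow>\<^sub>E {..d}) \<ge> card \<Omega>"
    proof (rule pigeonhole_card)
      show "c \<in> \<Omega> \<rightarrow> ({..<N} \<rightarrow>\<^sub>E {..d})" using c by (auto simp: good_def)
      show "finite ({..<N} \<rightarrow>\<^sub>E {..d})" by (simp add: finite_PiE)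
      show "({..<N} \<rightarrow>\<^sub>E {..d}) \<noteq> {}" by (auto simp: PiE_eq_empty_iff)
    qed (rule \<Omega>)
    then obtain \<phi> where \<phi>: "\<phi> \<in> {..<N} \<rightarrow>\<^sub>E {..d}"
        "card \<Omega> \<le> card (c -` {\<phi>} \<inter> \<Omega>) * (d + 1) ^ N"
      by (auto simp: card_PiE)
    define B where "B = c -` {\<phi>} \<inter> \<Omega>"
    \<comment> \<open>The matrix position (row, column) from which entry \<open>i\<close> of the
      mixed tuple is read.\<close>
    define g where "g i = (\<phi> i, i)" for i
    define J where "J = {..d} \<times> {..<N}"
    define G where "G = {F \<in> {..d} \<rightarrow>\<^sub>E \<Omega>. (\<Inter>j\<in>{..d}. convex hull (x ` F j ` {..<N})) \<noteq> {}}"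
    have g: "inj_on g {..<N}" "g ` {..<N} \<subseteq> J"
      using \<phi>(1) by (auto simp: g_def J_def inj_on_def)
    have "card B * card I ^ (card J - card {..<N}) =
        card {f \<in> J \<rightarrow>\<^sub>E I. restrict (f \<circ> g) {..<N} \<in> B}"
      using I g by (intro card_PiE_pullback[symmetric]) (auto simp: B_def \<Omega>_def J_def)
    also have "\<dots> \<le> card G"
    proof (rule card_inj_on_le)
      show "finite G" using \<Omega> by (auto simp: G_def intro!: finite_PiE)
      define curry' where "curry' f = (\<lambda>j\<in>{..d}. \<lambda>i\<in>{..<N}. f (j, i))" for f :: "nat \<times> nat \<Rightarrow> 'i"
      have curry': "curry' f j i = f (j, i)" if "j \<le> d" "i < N" for f i j
        using that by (simp add: curry'_def)
      show "inj_on curry' {f \<in> J \<rightarrow>\<^sub>E I. restrict (f \<circ> g) {..<N} \<in> B}"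
      proof (rule inj_onI)
        fix f f' assume f: "f \<in> {f \<in> J \<rightarrow>\<^sub>E I. restrict (f \<circ> g) {..<N} \<in> B}"
          "f' \<in> {f \<in> J \<rightarrow>\<^sub>E I. restrict (f \<circ> g) {..<N} \<in> B}" "curry' f = curry' f'"
        have "f ji = f' ji" if "ji \<in> J" for ji
          using that curry'[of "fst ji" "snd ji" f] curry'[of "fst ji" "snd ji" f'] f(3)
          by (auto simp: J_def)
        then show "f = f'"
          using f(1,2) by (intro PiE_ext[of f J "\<lambda>_. I" f']) auto
      qed
      show "curry' ` {f \<in> J \<rightarrow>\<^sub>E I. restrict (f \<circ> g) {..<N} \<in> B} \<subseteq> G"
      proof
        fix F assume "F \<in> curry' ` {f \<in> J \<rightarrow>\<^sub>E I. restrict (f \<circ> g) {..<N} \<in> B}"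
        then obtain f where f: "f \<in> J \<rightarrow>\<^sub>E I" "restrict (f \<circ> g) {..<N} \<in> B" "F = curry' f"
          by blast
        define y where "y = restrict (f \<circ> g) {..<N}"
        have "good y \<phi>" using f(2) c[of y] by (auto simp: B_def y_def)
        then obtain z where z: "\<And>j. j \<le> d \<Longrightarrow> z \<in> convex hull (x ` y ` {i. i < N \<and> \<phi> i = j})"
          by (auto simp: good_def)
        have "z \<in> convex hull (x ` F j ` {..<N})" if j: "j \<le> d" for j
        proof -
          \<comment> \<open>Entries of colour \<open>j\<close> were read from row \<open>j\<close>,
            so class \<open>j\<close> of \<open>y\<close> lies in that row.\<close>
          have "y i = F j i" if "i < N" "\<phi> i = j" for i
            using that j curry'[of j i f] by (simp add: y_def g_def f(3))
          then have "y ` {i. i < N \<and> \<phi> i = j} \<subseteq> F j ` {..<N}" by auto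
          then have "convex hull (x ` y ` {i. i < N \<and> \<phi> i = j}) \<subseteq> convex hull (x ` F j ` {..<N})"
            by (intro hull_mono image_mono)
          then show ?thesis using z[OF j] by (rule subsetD)
        qed
        moreover have "F \<in> {..d} \<rightarrow>\<^sub>E \<Omega>"
          unfolding f(3) curry'_def \<Omega>_def restrict_PiE_iff
          by (intro ballI PiE_mem[OF f(1)]) (simp add: J_def)
        ultimately show "F \<in> G" unfolding G_def by blast
      qed
    qed
    \<comment> \<open>Of the \<open>(d + 1) * N\<close> matrix entries \<open>N\<close> are
      prescribed; the other \<open>d * N\<close> account for the factor
      \<open>card \<Omega> ^ d\<close>.\<close>
    finally have G_ge: "card B * card \<Omega> ^ d \<le> card G"
      by (simp add: J_def \<Omega>(2) power_mult[symmetric] mult.commute)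
    obtain z where z: "card G \<le> (d + 1) * card \<Omega> ^ d * card {h\<in>\<Omega>. z \<in> convex hull (x ` h ` {..<N})}"
      using fractional_Helly[of \<Omega> "\<lambda>h. convex hull (x ` h ` {..<N})"] \<Omega>(1)
      by (auto simp: G_def d_def finite_imp_compact_convex_hull compact_imp_closed)
    define m where "m = card {h\<in>\<Omega>. z \<in> convex hull (x ` h ` {..<N})}"
    have "card \<Omega> ^ d * card B = card B * card \<Omega> ^ d" by (rule mult.commute)
    also have "\<dots> \<le> card G" by (rule G_ge)
    also have "\<dots> \<le> (d + 1) * card \<Omega> ^ d * m" using z by (simp only: m_def)
    also have "\<dots> = card \<Omega> ^ d * ((d + 1) * m)" by (simp only: mult_ac)
    finally have "card B \<le> (d + 1) * m" using \<Omega>(3) by simp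
    then have "card B * (d + 1) ^ N \<le> (d + 1) * m * (d + 1) ^ N" by (rule mult_le_mono1)
    also have "\<dots> = L * m" by (simp only: L_def mult_ac)
    finally have "card B * (d + 1) ^ N \<le> L * m" .
    then have "card I ^ N \<le> L * m" using \<phi>(2) by (simp add: B_def \<Omega>(2))
    then show ?thesis by (auto simp: m_def \<Omega>_def)
  qed
  then show ?thesis by (intro exI[of _ N] exI[of _ L]) (auto simp: L_def)
qed

text \<open>
  Greedy construction: while some heavy convex set \<open>C\<close> is missed, a selected point for the points
  in \<open>C\<close> lies in the hulls of many tuples in \<open>C\<close>, and no earlier point lies in any of these.
\<close>

lemma weak_epsilon_net:
  fixes \<epsilon> :: real
  assumes "0 < \<epsilon>"
  shows "\<exists>k. \<forall>I (x :: 'i \<Rightarrow> 'a::euclidean_space). finite I \<longrightarrow> I \<noteq> {} \<longrightarrow>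
    (\<exists>Z. finite Z \<and> card Z \<le> k \<and>
      (\<forall>C. convex C \<longrightarrow> \<epsilon> * card I \<le> card {i\<in>I. x i \<in> C} \<longrightarrow> C \<inter> Z \<noteq> {}))"
proof -
  obtain N L where L: "0 < L" and sel: "\<And>I (x :: 'i \<Rightarrow> 'a). finite I \<Longrightarrow> I \<noteq> {} \<Longrightarrow>
     \<exists>z. card I ^ N \<le> L * card {h \<in> {..<N} \<rightarrow>\<^sub>E I. z \<in> convex hull (x ` h ` {..<N})}"
    using first_selection[where ?'i = 'i and ?'a = 'a] by blast
  \<comment> \<open>Every greedy step kills at least the fraction \<open>\<epsilon> ^ N / L\<close>
    of all \<open>N\<close>-tuples, so \<open>k\<close> steps would kill more tuples than
    exist.\<close>
  obtain k :: nat where k: "real L < real k * \<epsilon> ^ N"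
    using reals_Archimedean3[of "\<epsilon> ^ N"] assms by auto
  have "\<exists>Z. finite Z \<and> card Z \<le> k \<and>
      (\<forall>C. convex C \<longrightarrow> \<epsilon> * card I \<le> card {i\<in>I. x i \<in> C} \<longrightarrow> C \<inter> Z \<noteq> {})"
    if I: "finite I" "I \<noteq> {}" for I and x :: "'i \<Rightarrow> 'a"
  proof (rule ccontr)
    assume no_net: "\<not> ?thesis"
    \<comment> \<open>A tuple is killed once its hull meets \<open>Z\<close>. The induction below
      adds a point per step; by \<open>no_net\<close>, a missed heavy set is available while
      \<open>Z\<close> has at most \<open>k\<close> points.\<close>
    define killed where "killed Z = {h \<in> {..<N} \<rightarrow>\<^sub>E I. Z \<inter> convex hull (x ` h ` {..<N}) \<noteq> {}}" for Z
    have fin: "finite (killed Z)" for Z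
      using I by (auto simp: killed_def finite_PiE)
    have "\<exists>Z. finite Z \<and> card Z \<le> j \<and> j * (\<epsilon> * card I) ^ N \<le> L * card (killed Z)" if "j \<le> k" for j
      using that
    proof (induction j)
      case 0
      then show ?case by (intro exI[of _ "{}"]) simp
    next
      case (Suc j)
      then obtain Z where Z: "finite Z" "card Z \<le> j" "j * (\<epsilon> * card I) ^ N \<le> L * card (killed Z)"
        by auto
      moreover have "card Z \<le> k" using Z(2) Suc.prems by simp
      ultimately obtain C where C: "convex C" "\<epsilon> * card I \<le> card {i\<in>I. x i \<in> C}" "C \<inter> Z = {}"
        using no_net by blast
      define J where "J = {i\<in>I. x i \<in> C}"
      have "0 < \<epsilon> * card I" using assms I by (simp add: card_gt_0_iff)
      then have "0 < card J" using C(2) unfolding J_def by linarith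
      then have J: "finite J" "J \<noteq> {}" by (simp_all add: card_gt_0_iff)
      obtain z where z: "card J ^ N \<le> L * card {h \<in> {..<N} \<rightarrow>\<^sub>E J. z \<in> convex hull (x ` h ` {..<N})}"
        using sel[OF J] by blast
      define H where "H = {h \<in> {..<N} \<rightarrow>\<^sub>E J. z \<in> convex hull (x ` h ` {..<N})}"
      have hull_C: "convex hull (x ` h ` {..<N}) \<subseteq> C" if "h \<in> H" for h
        using that C(1) by (intro hull_minimal) (auto simp: H_def J_def)
      have "finite H" using J by (auto simp: H_def finite_PiE)
      moreover have "killed Z \<inter> H = {}" using hull_C C(3) by (auto simp: killed_def)
      moreover have "killed Z \<union> H \<subseteq> killed (insert z Z)"
        by (auto simp: killed_def H_def J_def)
      ultimately have "card (killed Z) + card H \<le> card (killed (insert z Z))"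
        using fin by (metis card_Un_disjoint card_mono)
      then have "real L * card (killed Z) + real L * card H \<le> real L * card (killed (insert z Z))"
        by (metis distrib_left mult_left_mono of_nat_0_le_iff of_nat_add of_nat_le_iff)
      moreover have "(\<epsilon> * card I) ^ N \<le> real L * card H"
      proof -
        have "(\<epsilon> * card I) ^ N \<le> real (card J) ^ N"
          using C(2) assms by (intro power_mono) (auto simp: J_def)
        also have "\<dots> \<le> real L * card H"
          using z unfolding H_def[symmetric] by (metis of_nat_le_iff of_nat_mult of_nat_power)
        finally show ?thesis .
      qed
      ultimately have "Suc j * (\<epsilon> * card I) ^ N \<le> L * card (killed (insert z Z))"
        using Z(3) by (simp add: distrib_right)
      moreover have "card (insert z Z) \<le> Suc j"
        using Z by (simp add: card_insert_if)
      ultimately show ?case using Z(1) by blast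
    qed
    from this[OF order_refl] obtain Z where Z: "k * (\<epsilon> * card I) ^ N \<le> L * card (killed Z)" by blast
    have "card (killed Z) \<le> card I ^ N"
      using card_mono[of "{..<N} \<rightarrow>\<^sub>E I" "killed Z"] I by (auto simp: killed_def finite_PiE card_PiE)
    then have "L * card (killed Z) \<le> L * card I ^ N" by simp
    then have "k * (\<epsilon> * card I) ^ N \<le> real L * real (card I) ^ N"
      using Z by (metis of_nat_le_iff of_nat_mult of_nat_power order_trans)
    then have "(k * \<epsilon> ^ N) * real (card I) ^ N \<le> real L * real (card I) ^ N"
      by (simp add: power_mult_distrib mult_ac)
    moreover have "0 < real (card I) ^ N" using I by (simp add: card_gt_0_iff)
    ultimately show False using k by (metis mult_le_cancel_right_pos not_le)
  qed
  then show ?thesis by blast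
qed

subsection \<open>Fractional transversals\<close>

text \<open>
  Multiplicative weights in place of linear programming duality: a set that has been hit \<open>h\<close> times
  has weight \<open>2 ^ -h\<close>. Multiplied by \<open>2 ^ T\<close> these weights become integers, realised as
  multiplicities of a new index set.
\<close>

lemma fractional_transversal:
  fixes F :: "'a set set" and \<beta> :: real
  assumes F: "finite F" "F \<noteq> {}" and \<beta>: "0 < \<beta>" "\<beta> \<le> 1"
    and heavy: "\<And>I :: ('a set \<times> nat) set. finite I \<Longrightarrow> I \<noteq> {} \<Longrightarrow> fst ` I \<subseteq> F \<Longrightarrow>
      \<exists>z. \<beta> * card I \<le> card {i\<in>I. z \<in> fst i}"
  shows "\<exists>(T :: nat) (z :: nat \<Rightarrow> 'a). 0 < T \<and> (\<forall>A\<in>F. \<beta> / 4 * T \<le> card {t\<in>{..<T}. z t \<in> A})"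
proof -
  define hits where "hits z T A = card {t\<in>{..<T}. z t \<in> A}" for z :: "nat \<Rightarrow> 'a" and T A
  have hits_le: "hits z T A \<le> T" for z T A
    unfolding hits_def by (rule order_trans[OF card_mono[of "{..<T}"]]) auto
  \<comment> \<open>The next point is chosen in sets carrying at least the fraction
    \<open>\<beta>\<close> of the total weight. Their weights are halved, so the total falls to at
    most \<open>1 - \<beta> / 2\<close> times its value.\<close>
  have "\<exists>z. (\<Sum>A\<in>F. (1/2) ^ hits z T A) \<le> card F * (1 - \<beta> / 2) ^ T" for T
  proof (induction T)
    case 0
    show ?case by (simp add: hits_def)
  next
    case (Suc T)
    then obtain z where z: "(\<Sum>A\<in>F. (1/2) ^ hits z T A) \<le> card F * (1 - \<beta> / 2) ^ T" by blast
    define w :: "'a set \<Rightarrow> real" where "w A = (1/2) ^ hits z T A" for A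
    \<comment> \<open>As \<open>hits z T A\<close> is at most \<open>T\<close>, the natural
      subtraction does not truncate, and the multiplicity is exactly \<open>2 ^ T\<close> times the
      weight.\<close>
    have w: "real (2 ^ (T - hits z T A)) = 2 ^ T * w A" for A
    proof -
      have "(2::real) ^ T = 2 ^ (T - hits z T A) * 2 ^ hits z T A"
        by (simp only: power_add[symmetric] le_add_diff_inverse2[OF hits_le])
      then show ?thesis by (simp add: w_def power_one_over)
    qed
    define I where "I = (SIGMA A:F. {..<(2::nat) ^ (T - hits z T A)})"
    obtain A where "A \<in> F" using F(2) by blast
    then have "(A, 0) \<in> I" by (simp add: I_def)
    then have "I \<noteq> {}" by blast
    moreover have "finite I" "fst ` I \<subseteq> F" using F(1) by (auto simp: I_def)
    ultimately obtain x where x: "\<beta> * card I \<le> card {i\<in>I. x \<in> fst i}"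
      using heavy by blast
    have "real (card I) = 2 ^ T * (\<Sum>A\<in>F. w A)"
      using F by (simp add: I_def w sum_distrib_left flip: of_nat_power)
    moreover have "{i\<in>I. x \<in> fst i} = (SIGMA A:{A\<in>F. x \<in> A}. {..<(2::nat) ^ (T - hits z T A)})"
      by (auto simp: I_def)
    then have "real (card {i\<in>I. x \<in> fst i}) = 2 ^ T * (\<Sum>A\<in>{A\<in>F. x \<in> A}. w A)"
      using F by (simp add: w sum_distrib_left flip: of_nat_power)
    ultimately have "2 ^ T * (\<beta> * (\<Sum>A\<in>F. w A)) \<le> 2 ^ T * (\<Sum>A\<in>{A\<in>F. x \<in> A}. w A)"
      using x by (simp add: mult_ac)
    then have heavy_x: "\<beta> * (\<Sum>A\<in>F. w A) \<le> (\<Sum>A\<in>{A\<in>F. x \<in> A}. w A)" by simp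
    define z' where "z' = z(T := x)"
    have "hits z' (Suc T) A = hits z T A + (if x \<in> A then 1 else 0)" for A
    proof -
      have "{t\<in>{..<Suc T}. z' t \<in> A} =
          {t\<in>{..<T}. z t \<in> A} \<union> (if x \<in> A then {T} else {})"
        by (auto simp: z'_def less_Suc_eq split: if_splits)
      then show ?thesis by (auto simp: hits_def)
    qed
    then have "(1/2) ^ hits z' (Suc T) A = w A - 1/2 * (if x \<in> A then w A else 0)" for A
      by (simp add: w_def)
    then have "(\<Sum>A\<in>F. (1/2) ^ hits z' (Suc T) A) =
        (\<Sum>A\<in>F. w A) - 1/2 * (\<Sum>A\<in>F. if x \<in> A then w A else 0)"
      by (simp add: sum_subtractf sum_distrib_left)
    also have "(\<Sum>A\<in>F. if x \<in> A then w A else 0) = (\<Sum>A\<in>{A\<in>F. x \<in> A}. w A)"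
      using F by (simp add: sum.inter_filter)
    also have "(\<Sum>A\<in>F. w A) - 1/2 * (\<Sum>A\<in>{A\<in>F. x \<in> A}. w A) \<le> (1 - \<beta> / 2) * (\<Sum>A\<in>F. w A)"
      using heavy_x by (simp add: algebra_simps)
    also have "\<dots> \<le> (1 - \<beta> / 2) * (card F * (1 - \<beta> / 2) ^ T)"
      using z \<beta> unfolding w_def by (intro mult_left_mono) auto
    finally show ?case by (intro exI[of _ z']) (simp add: mult_ac)
  qed
  note low_weight = this
  define n where "n = card F"
  have n: "0 < n" using F by (simp add: n_def card_gt_0_iff)
  \<comment> \<open>With this \<open>T\<close>, \<open>ln n\<close> uses up at most half of the
    decay \<open>\<beta> / 2 * T\<close> of the logarithm of the total weight.\<close>
  obtain T :: nat where T: "4 * ln n / \<beta> < T" using reals_Archimedean2 by blast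
  have "0 \<le> 4 * ln n / \<beta>" using n \<beta> by simp
  then have "0 < T" using T by linarith
  obtain z where z: "(\<Sum>A\<in>F. (1/2) ^ hits z T A) \<le> n * (1 - \<beta> / 2) ^ T"
    using low_weight[of T] by (auto simp: n_def)
  have "\<beta> / 4 * T \<le> hits z T A" if "A \<in> F" for A
  proof -
    \<comment> \<open>A single weight is at most the total. Logarithms turn this into a lower bound
      on the hits, using that \<open>ln (1 - \<beta> / 2)\<close> is at most
      \<open>- \<beta> / 2\<close> and \<open>ln 2\<close> at most 1.\<close>
    have "(1/2) ^ hits z T A \<le> (\<Sum>A\<in>F. (1/2::real) ^ hits z T A)"
      using F that by (intro member_le_sum) auto
    then have "(1/2) ^ hits z T A \<le> n * (1 - \<beta> / 2) ^ T" using z by simp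
    then have "ln ((1/2) ^ hits z T A) \<le> ln (n * (1 - \<beta> / 2) ^ T)"
      using n \<beta> by (subst ln_le_cancel_iff) auto
    then have "- (hits z T A * ln 2) \<le> ln n + T * ln (1 - \<beta> / 2)"
      using n \<beta> by (simp add: ln_mult ln_realpow ln_div)
    also have "\<dots> \<le> ln n + T * (- (\<beta> / 2))"
      using ln_le_minus_one[of "1 - \<beta> / 2"] \<beta> by (intro add_left_mono mult_left_mono) auto
    also have "ln n \<le> \<beta> / 4 * T" using T \<beta> by (simp add: field_simps)
    finally have "\<beta> / 4 * T \<le> hits z T A * ln 2" by (simp add: algebra_simps)
    also have "\<dots> \<le> real (hits z T A) * 1"
      using ln_le_minus_one[of "2::real"] by (intro mult_left_mono) auto
    finally show ?thesis by simp
  qed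
  then show ?thesis using \<open>0 < T\<close> by (auto simp: hits_def)
qed

subsection \<open>The (p,q) theorem\<close>

lemma pq_property_subset:
  "pq_property p q \<F> \<Longrightarrow> \<G> \<subseteq> \<F> \<Longrightarrow> pq_property p q \<G>"
  unfolding pq_property_def by (intro allI impI, drule spec, erule mp) blast

text \<open>The (p,q) property concerns distinct sets, but indexed families may repeat them. If at
  least \<open>p\<close> distinct sets occur, the property applies and one index is taken for each
  of \<open>r\<close> intersecting sets. Otherwise some set occurs at least \<open>r\<close> times,
  and these copies meet because it is nonempty.\<close>

lemma pq_property_repeated:
  assumes pq: "pq_property p q \<F>" and "r \<le> q" "q \<le> p" "0 < p"
    and "finite J" "card J = p * r" and S: "S ` J \<subseteq> \<F>" and ne: "{} \<notin> \<F>"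
  shows "\<exists>W\<subseteq>J. card W = r \<and> (\<Inter>i\<in>W. S i) \<noteq> {}"
proof (cases "p \<le> card (S ` J)")
  case True
  then obtain \<G> where \<G>: "\<G> \<subseteq> S ` J" "card \<G> = p" "finite \<G>"
    by (rule obtain_subset_with_card_n)
  then obtain \<H> where \<H>: "\<H> \<subseteq> \<G>" "card \<H> = q" "\<Inter>\<H> \<noteq> {}"
    using pq S unfolding pq_property_def by (metis subset_trans)
  obtain \<K> where \<K>: "\<K> \<subseteq> \<H>" "card \<K> = r"
    using obtain_subset_with_card_n[of r \<H>] \<H>(2) \<open>r \<le> q\<close> by metis
  then have "\<K> \<subseteq> S ` J" using \<G> \<H> by blast
  then obtain W where W: "W \<subseteq> J" "inj_on S W" "\<K> = S ` W"
    unfolding subset_image_inj by blast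
  have "\<Inter>\<H> \<subseteq> (\<Inter>i\<in>W. S i)" using \<K>(1) W(3) by blast
  then have "(\<Inter>i\<in>W. S i) \<noteq> {}" using \<H>(3) by blast
  moreover have "card W = r" using \<K>(2) W by (simp add: card_image)
  ultimately show ?thesis using W(1) by blast
next
  case False
  show ?thesis
  proof (cases "J = {}")
    case True
    \<comment> \<open>Here \<open>r\<close> is 0, and the intersection over no indices is the whole
      space.\<close>
    then show ?thesis using assms by (intro exI[of _ "{}"]) simp
  next
    case J: False
    obtain A where A: "A \<in> S ` J" "card J \<le> card (S -` {A} \<inter> J) * card (S ` J)"
      using pigeonhole_card[of S J "S ` J"] J \<open>finite J\<close> by auto
    have "p * r \<le> card (S -` {A} \<inter> J) * card (S ` J)" using A(2) assms(6) by simp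
    also have "\<dots> \<le> card (S -` {A} \<inter> J) * p" using False by (intro mult_le_mono2) simp
    also have "\<dots> = p * card (S -` {A} \<inter> J)" by (rule mult.commute)
    finally have "p * r \<le> p * card (S -` {A} \<inter> J)" .
    then have "r \<le> card (S -` {A} \<inter> J)" using \<open>0 < p\<close> by simp
    then obtain W where W: "W \<subseteq> S -` {A} \<inter> J" "card W = r"
      by (metis obtain_subset_with_card_n)
    have "A \<subseteq> (\<Inter>i\<in>W. S i)" using W(1) by auto
    moreover have "A \<noteq> {}" using A(1) S ne by blast
    ultimately show ?thesis using W by (intro exI[of _ W]) auto
  qed
qed

text \<open>Every tuple of \<open>p * (d + 1)\<close> indices has d + 1 positions whose sets meet.
  By pigeonhole the same positions work for many tuples, so a positive fraction of all (d +
  1)-tuples intersects and fractional Helly applies.\<close>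

lemma pq_heavy_point:
  fixes \<F> :: "'a::euclidean_space set set"
  assumes pq: "pq_property p q \<F>" and pqd: "DIM('a) + 1 \<le> q" "q \<le> p"
    and \<F>: "compact_convex_family \<F>" and I: "finite I" "I \<noteq> {}" and S: "S ` I \<subseteq> \<F>"
  shows "\<exists>z. card I \<le> (p * (DIM('a) + 1)) ^ (DIM('a) + 1) * (DIM('a) + 1) * card {i\<in>I. z \<in> S i}"
proof -
  define d where "d = DIM('a)"
  define N where "N = p * (d + 1)"
  define n where "n = card I"
  have n: "0 < n" using I by (simp add: n_def card_gt_0_iff)
  have "0 < p" using pqd by simp
  then have N: "d + 1 \<le> N" unfolding N_def by (cases p) simp_all
  define \<Omega> where "\<Omega> = {..<N} \<rightarrow>\<^sub>E I"
  have "\<exists>g\<in>{..d} \<rightarrow>\<^sub>E {..<N}. inj_on g {..d} \<and> (\<Inter>k\<in>{..d}. S (f (g k))) \<noteq> {}" if "f \<in> \<Omega>" for f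
  proof -
    have "\<exists>W\<subseteq>{..<N}. card W = d + 1 \<and> (\<Inter>i\<in>W. (S \<circ> f) i) \<noteq> {}"
    proof (rule pq_property_repeated[OF pq])
      show "(S \<circ> f) ` {..<N} \<subseteq> \<F>" using that S by (auto simp: \<Omega>_def)
      show "{} \<notin> \<F>" using \<F> by (auto simp: compact_convex_family_def)
    qed (use pqd \<open>0 < p\<close> in \<open>auto simp: d_def N_def\<close>)
    then obtain W where W: "W \<subseteq> {..<N}" "card W = d + 1" "(\<Inter>i\<in>W. S (f i)) \<noteq> {}"
      by auto
    obtain g where g: "bij_betw g {..d} W"
      using finite_same_card_bij[of "{..d}" W] W finite_subset[OF W(1)] by auto
    define g' where "g' = restrict g {..d}"
    have "inj_on g' {..d}" using g by (simp add: g'_def bij_betw_def inj_on_def)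
    moreover have "g' \<in> {..d} \<rightarrow>\<^sub>E {..<N}"
      using g W(1) by (auto simp: g'_def bij_betw_def)
    moreover have "(\<Inter>i\<in>W. S (f i)) = (\<Inter>k\<in>{..d}. S (f (g' k)))"
      using g by (auto simp: g'_def bij_betw_def)
    ultimately show ?thesis using W(3) by (intro bexI[of _ g']) auto
  qed
  then obtain c where c: "\<And>f. f \<in> \<Omega> \<Longrightarrow> c f \<in> {..d} \<rightarrow>\<^sub>E {..<N} \<and> inj_on (c f) {..d} \<and>
      (\<Inter>k\<in>{..d}. S (f (c f k))) \<noteq> {}"
    by metis
  have \<Omega>: "finite \<Omega>" "card \<Omega> = n ^ N" "\<Omega> \<noteq> {}"
    using I by (simp_all add: \<Omega>_def n_def finite_PiE card_PiE PiE_eq_empty_iff)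
  have "\<exists>g\<in>{..d} \<rightarrow>\<^sub>E {..<N}. card \<Omega> \<le> card (c -` {g} \<inter> \<Omega>) * card ({..d} \<rightarrow>\<^sub>E {..<N})"
  proof (rule pigeonhole_card)
    show "c \<in> \<Omega> \<rightarrow> ({..d} \<rightarrow>\<^sub>E {..<N})" using c by blast
    then show "({..d} \<rightarrow>\<^sub>E {..<N}) \<noteq> {}" using \<Omega>(3) by blast
  qed (simp_all add: \<Omega> finite_PiE)
  then obtain g where g: "g \<in> {..d} \<rightarrow>\<^sub>E {..<N}"
      "n ^ N \<le> card (c -` {g} \<inter> \<Omega>) * N ^ (d + 1)"
    by (auto simp: card_PiE \<Omega>(2))
  define G where "G = {h \<in> {..d} \<rightarrow>\<^sub>E I. (\<Inter>k\<in>{..d}. S (h k)) \<noteq> {}}"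
  have "0 < n ^ N" using n by simp
  \<comment> \<open>Pigeonhole yields \<open>g\<close> only as some function; a tuple in its
    nonempty class shows that \<open>g\<close> was chosen by \<open>c\<close> and is therefore
    injective, as the pullback count requires.\<close>
  then have "card (c -` {g} \<inter> \<Omega>) \<noteq> 0" using g(2) by (metis le_zero_eq mult_zero_left not_less_zero)
  then obtain f where "f \<in> \<Omega>" "c f = g" by (metis IntE card.empty ex_in_conv vimage_singleton_eq)
  then have inj: "inj_on g {..d}" using c by blast
  have "c -` {g} \<inter> \<Omega> \<subseteq> {f \<in> {..<N} \<rightarrow>\<^sub>E I. restrict (f \<circ> g) {..d} \<in> G}"
  proof
    fix f assume f: "f \<in> c -` {g} \<inter> \<Omega>"
    then have "(\<Inter>k\<in>{..d}. S (restrict (f \<circ> g) {..d} k)) \<noteq> {}" using c[of f] by auto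
    moreover have "restrict (f \<circ> g) {..d} \<in> {..d} \<rightarrow>\<^sub>E I"
      using f g(1) unfolding restrict_PiE_iff by (auto simp: \<Omega>_def PiE_iff)
    ultimately show "f \<in> {f \<in> {..<N} \<rightarrow>\<^sub>E I. restrict (f \<circ> g) {..d} \<in> G}"
      using f by (auto simp: G_def \<Omega>_def)
  qed
  then have "card (c -` {g} \<inter> \<Omega>) \<le> card {f \<in> {..<N} \<rightarrow>\<^sub>E I. restrict (f \<circ> g) {..d} \<in> G}"
    using I by (intro card_mono) (auto simp: finite_PiE)
  also have "\<dots> = card G * n ^ (N - (d + 1))"
    using I inj g(1) by (subst card_PiE_pullback) (auto simp: G_def n_def)
  finally have "n ^ N \<le> card G * n ^ (N - (d + 1)) * N ^ (d + 1)"
    using g(2) by (meson le_trans mult_le_mono1)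
  moreover have "n ^ N = n ^ (N - (d + 1)) * n ^ (d + 1)"
    by (simp only: power_add[symmetric] le_add_diff_inverse2[OF N])
  ultimately have "n ^ (N - (d + 1)) * n ^ (d + 1) \<le> n ^ (N - (d + 1)) * (card G * N ^ (d + 1))"
    by (simp only: mult_ac)
  then have G_ge: "n ^ (d + 1) \<le> card G * N ^ (d + 1)"
    using n by (subst (asm) mult_le_cancel1) simp
  have SI: "closed (S i)" "convex (S i)" if "i \<in> I" for i
    using that S \<F> by (auto simp: compact_convex_family_def compact_imp_closed)
  then obtain z where z: "card G \<le> (d + 1) * n ^ d * card {i\<in>I. z \<in> S i}"
    using fractional_Helly[OF I(1), of S] unfolding G_def n_def d_def by blast
  have "n ^ d * n = n ^ (d + 1)" by simp
  also have "\<dots> \<le> card G * N ^ (d + 1)" by (rule G_ge)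
  also have "\<dots> \<le> (d + 1) * n ^ d * card {i\<in>I. z \<in> S i} * N ^ (d + 1)"
    using z by (rule mult_le_mono1)
  also have "\<dots> = n ^ d * (N ^ (d + 1) * (d + 1) * card {i\<in>I. z \<in> S i})"
    by (simp only: mult_ac)
  finally have "n \<le> N ^ (d + 1) * (d + 1) * card {i\<in>I. z \<in> S i}"
    using n by (subst (asm) mult_le_cancel1) simp
  then show ?thesis unfolding n_def N_def d_def by blast
qed

text \<open>Heavy points for all multiplicities give a point sequence of which every member contains
  the fraction \<open>\<beta> / 4\<close>; a weak net for that fraction meets every member. The net
  size \<open>k\<close> is fixed before the family.\<close>

lemma pq_theorem_finite:
  assumes pqd: "DIM('a::euclidean_space) + 1 \<le> q" "q \<le> p"
  shows "\<exists>k. \<forall>\<F> :: 'a set set. finite \<F> \<longrightarrow> compact_convex_family \<F> \<longrightarrow> pq_property p q \<F> \<longrightarrow>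
    (\<exists>X. finite X \<and> card X \<le> k \<and> (\<forall>A\<in>\<F>. A \<inter> X \<noteq> {}))"
proof -
  define M where "M = (p * (DIM('a) + 1)) ^ (DIM('a) + 1) * (DIM('a) + 1)"
  define \<beta> :: real where "\<beta> = 1 / M"
  have "0 < p" using pqd by simp
  then have "0 < M" by (simp add: M_def)
  then have "1 \<le> M" by simp
  then have \<beta>: "0 < \<beta>" "\<beta> \<le> 1" by (simp_all add: \<beta>_def)
  have "0 < \<beta> / 4" using \<beta> by simp
  from weak_epsilon_net[OF this, where ?'i = nat and ?'a = 'a]
  obtain k where k: "\<And>I (x :: nat \<Rightarrow> 'a). finite I \<Longrightarrow> I \<noteq> {} \<Longrightarrow>
    \<exists>Z. finite Z \<and> card Z \<le> k \<and>
      (\<forall>C. convex C \<longrightarrow> \<beta> / 4 * card I \<le> card {i\<in>I. x i \<in> C} \<longrightarrow> C \<inter> Z \<noteq> {})"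
    by blast
  have "\<exists>X. finite X \<and> card X \<le> k \<and> (\<forall>A\<in>\<F>. A \<inter> X \<noteq> {})"
    if \<F>: "finite \<F>" "compact_convex_family \<F>" "pq_property p q \<F>" for \<F> :: "'a set set"
  proof (cases "\<F> = {}")
    case True
    then show ?thesis by (intro exI[of _ "{}"]) simp
  next
    case False
    have "\<exists>(T :: nat) (z :: nat \<Rightarrow> 'a). 0 < T \<and> (\<forall>A\<in>\<F>. \<beta> / 4 * T \<le> card {t\<in>{..<T}. z t \<in> A})"
    proof (rule fractional_transversal[OF \<F>(1) False \<beta>])
      fix I :: "('a set \<times> nat) set"
      assume I: "finite I" "I \<noteq> {}" "fst ` I \<subseteq> \<F>"
      obtain z where z: "card I \<le> M * card {i\<in>I. z \<in> fst i}"
        using pq_heavy_point[OF \<F>(3) pqd \<F>(2) I] unfolding M_def by blast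
      then have "real (card I) \<le> real M * card {i\<in>I. z \<in> fst i}"
        by (metis of_nat_le_iff of_nat_mult)
      then show "\<exists>z. \<beta> * card I \<le> card {i\<in>I. z \<in> fst i}"
        using \<open>1 \<le> M\<close> by (intro exI[of _ z]) (simp add: \<beta>_def divide_le_eq mult.commute)
    qed
    then obtain T :: nat and z :: "nat \<Rightarrow> 'a"
      where T: "0 < T" "\<And>A. A \<in> \<F> \<Longrightarrow> \<beta> / 4 * T \<le> card {t\<in>{..<T}. z t \<in> A}"
      by blast
    have "finite {..<T}" "{..<T} \<noteq> {}" using T(1) by auto
    from k[OF this, of z] obtain Z where Z: "finite Z" "card Z \<le> k"
      "\<And>C. convex C \<Longrightarrow> \<beta> / 4 * T \<le> card {t\<in>{..<T}. z t \<in> C} \<Longrightarrow> C \<inter> Z \<noteq> {}"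
      unfolding card_lessThan by blast
    have "A \<inter> Z \<noteq> {}" if A: "A \<in> \<F>" for A
    proof (rule Z(3)[OF _ T(2)[OF A]])
      show "convex A" using A \<F>(2) by (simp add: compact_convex_family_def)
    qed
    then show ?thesis using Z(1,2) by blast
  qed
  then show ?thesis by blast
qed

text \<open>
  If no point \<open>x\<close> of a fixed member \<open>A\<close> can be part of the transversal, this is due to a finite
  subfamily avoiding a neighbourhood of \<open>x\<close>; finitely many of these neighbourhoods cover \<open>A\<close>.
\<close>

lemma compact_transversal:
  fixes \<F> :: "'a::t2_space set set"
  assumes "\<And>A. A \<in> \<F> \<Longrightarrow> compact A"
    and "\<And>\<G>. \<G> \<subseteq> \<F> \<Longrightarrow> finite \<G> \<Longrightarrow> \<exists>X. finite X \<and> card X \<le> k \<and> (\<forall>A\<in>\<G>. A \<inter> X \<noteq> {})"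
  shows "\<exists>X. finite X \<and> card X \<le> k \<and> (\<forall>A\<in>\<F>. A \<inter> X \<noteq> {})"
  using assms
proof (induction k arbitrary: \<F>)
  case 0
  have "A \<notin> \<F>" for A
    using "0.prems"(2)[of "{A}"] by auto
  then show ?case by auto
next
  case (Suc k)
  show ?case
  proof (cases "\<F> = {}")
    case True
    then show ?thesis by (intro exI[of _ "{}"]) simp
  next
    case False
    then obtain A where A: "A \<in> \<F>" by blast
    define pierced where "pierced j \<G> \<longleftrightarrow> (\<exists>X. finite X \<and> card X \<le> j \<and> (\<forall>A\<in>\<G>. A \<inter> X \<noteq> {}))"
      for j and \<G> :: "'a set set"
    have "\<exists>x\<in>A. \<forall>\<G>. \<G> \<subseteq> {B\<in>\<F>. x \<notin> B} \<longrightarrow> finite \<G> \<longrightarrow> pierced k \<G>"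
    proof (rule ccontr)
      assume "\<not> ?thesis"
      then obtain \<G> where \<G>: "\<And>x. x \<in> A \<Longrightarrow> \<G> x \<subseteq> {B\<in>\<F>. x \<notin> B} \<and> finite (\<G> x) \<and> \<not> pierced k (\<G> x)"
        by metis
      obtain D where D: "D \<subseteq> A" "finite D" "A \<subseteq> (\<Union>x\<in>D. - \<Union>(\<G> x))"
      proof (rule compactE_image)
        show "compact A" using Suc.prems(1) A .
        show "A \<subseteq> (\<Union>x\<in>A. - \<Union>(\<G> x))" using \<G> by blast
      next
        fix x assume x: "x \<in> A"
        have "closed (\<Union>(\<G> x))"
          using \<G>[OF x] Suc.prems(1) by (intro closed_Union) (auto intro: compact_imp_closed)
        then show "open (- \<Union>(\<G> x))" by (rule open_Compl)
      qed
      have "pierced (Suc k) (insert A (\<Union>x\<in>D. \<G> x))"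
        unfolding pierced_def using A D(1,2) \<G> by (intro Suc.prems(2)) auto
      then obtain X where X: "finite X" "card X \<le> Suc k" "A \<inter> X \<noteq> {}"
          "\<And>x B. x \<in> D \<Longrightarrow> B \<in> \<G> x \<Longrightarrow> B \<inter> X \<noteq> {}"
        unfolding pierced_def by auto
      then obtain y where y: "y \<in> A" "y \<in> X" by blast
      then obtain x where x: "x \<in> D" "y \<notin> \<Union>(\<G> x)" using D(3) by blast
      \<comment> \<open>\<open>y\<close> lies in no member of \<open>\<G> x\<close>, so the at most
        \<open>k\<close> other points of \<open>X\<close> already pierce \<open>\<G> x\<close>,
        contrary to its choice.\<close>
      have "\<forall>B\<in>\<G> x. B \<inter> (X - {y}) \<noteq> {}" using X(4)[OF x(1)] x(2) by blast
      moreover have "card (X - {y}) \<le> k" using X(1,2) y(2) by simp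
      ultimately have "pierced k (\<G> x)" using X(1) unfolding pierced_def by blast
      then show False using \<G> x(1) D(1) by blast
    qed
    then obtain x where x: "\<And>\<G>. \<G> \<subseteq> {B\<in>\<F>. x \<notin> B} \<Longrightarrow> finite \<G> \<Longrightarrow> pierced k \<G>" by blast
    \<comment> \<open>The members missing \<open>x\<close> may again form an infinite family; the
      induction is therefore over arbitrary \<open>\<F>\<close>.\<close>
    obtain X where X: "finite X" "card X \<le> k" "\<And>B. B \<in> {B\<in>\<F>. x \<notin> B} \<Longrightarrow> B \<inter> X \<noteq> {}"
      using Suc.IH[of "{B\<in>\<F>. x \<notin> B}"] Suc.prems(1) x unfolding pierced_def by auto
    have "B \<inter> insert x X \<noteq> {}" if "B \<in> \<F>" for B
      using X(3)[of B] that by auto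
    moreover have "card (insert x X) \<le> Suc k" using X by (simp add: card_insert_if)
    ultimately show ?thesis using X(1) by blast
  qed
qed

text \<open>Choosing for each member a point of \<open>X\<close> in it and grouping members by this
  point gives classes with a common point, at most one per point of \<open>X\<close>.\<close>

lemma piercing_number_le:
  assumes X: "finite X" "card X \<le> k" "\<And>A. A \<in> \<F> \<Longrightarrow> A \<inter> X \<noteq> {}"
  shows "piercing_number \<F> \<le> enat k"
proof -
  have "\<forall>A\<in>\<F>. \<exists>x. x \<in> A \<inter> X" using X(3) by blast
  then obtain c where c: "\<And>A. A \<in> \<F> \<Longrightarrow> c A \<in> A \<inter> X" by metis
  \<comment> \<open>Only points actually chosen give a class, since a partition has no empty
    classes.\<close>
  define P where "P = (\<lambda>x. {A\<in>\<F>. c A = x}) ` (c ` \<F>)"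
  have cX: "c ` \<F> \<subseteq> X" using c by blast
  have "partition_on \<F> P"
    by (rule partition_onI) (auto simp: P_def disjnt_def)
  moreover have "finite P" using finite_subset[OF cX X(1)] by (simp add: P_def)
  moreover have "card P \<le> k"
    using card_image_le[OF finite_subset[OF cX X(1)]] card_mono[OF X(1) cX] X(2)
    unfolding P_def by (meson le_trans)
  moreover have "\<Inter>\<G> \<noteq> {}" if \<G>: "\<G> \<in> P" for \<G>
  proof -
    obtain x where "\<G> = {A\<in>\<F>. c A = x}" using \<G> by (auto simp: P_def)
    then have "x \<in> \<Inter>\<G>" using c by blast
    then show ?thesis by blast
  qed
  ultimately have "pierceable k \<F>" unfolding pierceable_def by blast
  then show ?thesis unfolding piercing_number_def by (auto intro: Least_le)
qed

theorem theorem1p1: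
  fixes p q d :: nat
  assumes "d = CARD('n::finite)" and "p > 0" and "q > 0" and "d > 0"
    and "q \<ge> d + 1" and "p \<ge> q"
  shows "\<exists>c::nat.
      max_piercing_number p q TYPE('n) \<le> enat c \<and>
      (\<forall>\<F> :: (real ^ 'n) set set.
         compact_convex_family \<F> \<and> pq_property p q \<F> \<longrightarrow>
         (\<exists>X :: (real ^ 'n) set. finite X \<and> card X \<le> c \<and> (\<forall>A\<in>\<F>. A \<inter> X \<noteq> {})))"
proof -
  have "DIM(real ^ 'n) + 1 \<le> q" using assms by simp
  from pq_theorem_finite[OF this assms(6)]
  obtain k where k: "\<And>\<F> :: (real ^ 'n) set set. finite \<F> \<Longrightarrow> compact_convex_family \<F> \<Longrightarrow>
      pq_property p q \<F> \<Longrightarrow> \<exists>X. finite X \<and> card X \<le> k \<and> (\<forall>A\<in>\<F>. A \<inter> X \<noteq> {})"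
    by blast
  \<comment> \<open>Compactness loses no points, so the constant for finite families serves all
    families.\<close>
  have transversal: "\<exists>X. finite X \<and> card X \<le> k \<and> (\<forall>A\<in>\<F>. A \<inter> X \<noteq> {})"
    if \<F>: "compact_convex_family \<F>" "pq_property p q \<F>" for \<F> :: "(real ^ 'n) set set"
  proof (rule compact_transversal)
    show "compact A" if "A \<in> \<F>" for A using \<F>(1) that by (simp add: compact_convex_family_def)
  next
    fix \<G> assume \<G>: "\<G> \<subseteq> \<F>" "finite \<G>"
    have "compact_convex_family \<G>" using \<F>(1) \<G>(1) by (auto simp: compact_convex_family_def)
    moreover have "pq_property p q \<G>"
      using \<F>(2) \<G>(1) by (rule pq_property_subset)
    ultimately show "\<exists>X. finite X \<and> card X \<le> k \<and> (\<forall>A\<in>\<G>. A \<inter> X \<noteq> {})"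
      by (intro k \<G>(2))
  qed
  have "max_piercing_number p q TYPE('n) \<le> enat k"
    unfolding max_piercing_number_def
  proof (rule SUP_least)
    fix \<F> :: "(real ^ 'n) set set"
    assume "\<F> \<in> {\<F>. compact_convex_family \<F> \<and> pq_property p q \<F>}"
    then obtain X where "finite X" "card X \<le> k" "\<forall>A\<in>\<F>. A \<inter> X \<noteq> {}"
      using transversal[of \<F>] by blast
    then show "piercing_number \<F> \<le> enat k" by (intro piercing_number_le) auto
  qed
  then show ?thesis using transversal by blast
qed

end
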